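(* Let $G$ be the group of Construction A in the context with $q$ odd. Then the nilpotency class of $G$ is $2$ or $3$, and it is $3$ if and only if $\deg(S_1)>1$.
   Context: Let $q=p^m$ with $p$ prime. $E(a,b,c,t)$ is the $4\times4$ matrix with rows $(1,0,0,0),(-c,1,0,0),(b-ct,t,1,0),(a,b,c,1)$. Construction A: let $S_1(X)=\sum_{i=0}^{m-1}s_iX^{p^i}$ be a reduced linearized polynomial over $\mathbb{F}_q$, and $G=\{E(a,b,c,S_1(c)):a,b,c\in\mathbb{F}_q\}$, a group under matrix multiplication (here all Frobenius parts are trivial). $\deg(S_1)$ is the degree of the polynomial $S_1$. *)

theory Defs
  imports
    "HOL-Analysis.Analysis"
    "HOL-Algebra.Generated_Groups"
    "HOL-Computational_Algebra.Computational_Algebra"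
begin

primrec lower_central_series :: "('g, 'r) monoid_scheme \<Rightarrow> nat \<Rightarrow> 'g set" where
  "lower_central_series G 0 = carrier G"
| "lower_central_series G (Suc n) =
     generate G (\<Union>x \<in> lower_central_series G n. \<Union>y \<in> carrier G.
       {x \<otimes>\<^bsub>G\<^esub> y \<otimes>\<^bsub>G\<^esub> inv\<^bsub>G\<^esub> x \<otimes>\<^bsub>G\<^esub> inv\<^bsub>G\<^esub> y})"

definition nilpotent :: "('g, 'r) monoid_scheme \<Rightarrow> bool" where
  "nilpotent G \<longleftrightarrow> group G \<and> (\<exists>n. lower_central_series G n = {\<one>\<^bsub>G\<^esub>})"

text \<open>The series is indexed from 0, so the class is the least index of a trivial term; the value
  is meaningful only for nilpotent groups.\<close>

definition nilpotency_class :: "('g, 'r) monoid_scheme \<Rightarrow> nat" where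
  "nilpotency_class G = (LEAST n. lower_central_series G n = {\<one>\<^bsub>G\<^esub>})"

definition E :: "'a::field \<Rightarrow> 'a \<Rightarrow> 'a \<Rightarrow> 'a \<Rightarrow> 'a^4^4" where
  "E a b c t = vector
     [vector [1,         0, 0, 0],
      vector [- c,       1, 0, 0],
      vector [b - c * t, t, 1, 0],
      vector [a,         b, c, 1]]"

definition linearized_poly :: "nat \<Rightarrow> nat \<Rightarrow> (nat \<Rightarrow> 'a::field) \<Rightarrow> 'a poly" where
  "linearized_poly p m s = (\<Sum>i<m. monom (s i) (p ^ i))"

definition construction_A :: "'a::field poly \<Rightarrow> ('a^4^4) monoid" where
  "construction_A S =
     \<lparr>carrier = {E a b c (poly S c) | a b c. True}, monoid.mult = (**), one = mat 1\<rparr>"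

lemma vector_4 [simp]:
  "(vector [x, y, z, w] :: 'b::zero^4) $ 1 = x"
  "(vector [x, y, z, w] :: 'b::zero^4) $ 2 = y"
  "(vector [x, y, z, w] :: 'b::zero^4) $ 3 = z"
  "(vector [x, y, z, w] :: 'b::zero^4) $ 4 = w"
  unfolding vector_def by simp_all

lemma E_mult:
  "E a b c t ** E a' b' c' t' =
     E (a + a' - b * c' + c * (b' - c' * t')) (b + b' + c * t') (c + c') (t + t')"
  by (simp add: E_def matrix_matrix_mult_def vec_eq_iff forall_4 sum_4 algebra_simps)

lemma E_one: "E 0 0 0 0 = mat 1"
  by (simp add: E_def mat_def vec_eq_iff forall_4)

lemma CHAR_of_card:
  assumes "prime p" "CARD('a::{field,finite}) = p ^ m"
  shows "CHAR('a) = p"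
proof -
  have "bij (\<lambda>x::'a. x + 1)"
    by (rule bij_betw_byWitness[where f' = "\<lambda>x. x - 1"]) auto
  then have "(\<Sum>x\<in>UNIV. x + 1) = (\<Sum>x\<in>UNIV. x :: 'a)"
    by (rule sum.reindex_bij_betw)
  then have "of_nat CARD('a) = (0 :: 'a)"
    by (simp add: sum.distrib)
  then have "CHAR('a) dvd p ^ m"
    using assms(2) by (metis of_nat_eq_0_iff_char_dvd)
  moreover have "prime CHAR('a)"
    using prime_CHAR_semidom[where ?'a = 'a] finite_imp_CHAR_pos[where ?'a = 'a] by simp
  ultimately show ?thesis
    using assms(1) prime_dvd_power primes_dvd_imp_eq by blast
qed

lemma poly_linearized_poly_add:
  fixes s :: "nat \<Rightarrow> 'a::{field,finite}"
  assumes "prime p" "CARD('a) = p ^ m"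
  shows "poly (linearized_poly p m s) (x + y) =
    poly (linearized_poly p m s) x + poly (linearized_poly p m s) y"
proof -
  have "(x + y) ^ p ^ i = x ^ p ^ i + y ^ p ^ i" for i
    using freshmans_dream'[of "p ^ i" i x y] assms CHAR_of_card[OF assms] by simp
  then show ?thesis
    by (simp add: linearized_poly_def poly_sum poly_monom distrib_left sum.distrib)
qed

lemma group_construction_A:
  fixes S :: "'a::field poly"
  assumes add: "\<And>x y. poly S (x + y) = poly S x + poly S y"
  shows "group (construction_A S)"
proof (rule groupI)
  have zero: "poly S 0 = 0" using add[of 0 0] by (metis add_0 add_cancel_right_left)
  have neg: "poly S (- x) = - poly S x" for x
    using add[of x "- x"] zero by (simp add: eq_neg_iff_add_eq_0 add.commute)
  fix x y z
  show "\<one>\<^bsub>construction_A S\<^esub> \<in> carrier (construction_A S)"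
    unfolding construction_A_def using zero E_one by (auto intro!: exI[of _ 0] simp: E_one)
  assume x: "x \<in> carrier (construction_A S)"
  then obtain a b c where xe: "x = E a b c (poly S c)" by (auto simp: construction_A_def)
  show "\<one>\<^bsub>construction_A S\<^esub> \<otimes>\<^bsub>construction_A S\<^esub> x = x"
    by (simp add: construction_A_def)
  have "E ((c * poly S c - b) * c + c * (b - c * poly S c) - a) (c * poly S c - b) (- c) (poly S (- c)) ** x = mat 1"
    by (simp add: xe E_mult neg flip: E_one)
  then show "\<exists>y\<in>carrier (construction_A S). y \<otimes>\<^bsub>construction_A S\<^esub> x = \<one>\<^bsub>construction_A S\<^esub>"
    by (auto simp: construction_A_def)
  assume y: "y \<in> carrier (construction_A S)"
  show "x \<otimes>\<^bsub>construction_A S\<^esub> y \<in> carrier (construction_A S)"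
    using x y by (simp add: construction_A_def) (metis E_mult add)
  show "x \<otimes>\<^bsub>construction_A S\<^esub> y \<otimes>\<^bsub>construction_A S\<^esub> z =
     x \<otimes>\<^bsub>construction_A S\<^esub> (y \<otimes>\<^bsub>construction_A S\<^esub> z)"
    by (simp add: construction_A_def matrix_mul_assoc)
qed

end

theory Submission
  imports Defs
begin

text \<open>
  Write \<open>S\<close> for the additive polynomial. The commutator of \<open>E a b c (S c)\<close> and \<open>E a' b' c' (S c')\<close>
  is \<open>E \<alpha> \<beta> 0 0\<close> with \<open>\<beta> = c S(c') - c' S(c)\<close>, and for \<open>c = 0\<close> it is \<open>E (-2 b c') 0 0 0\<close>.
  Hence, in the lower central series indexed from 0, term 3 is always trivial, term 1 never is
  in odd characteristic, and term 2 is trivial exactly if \<open>\<beta>\<close> vanishes identically, i.e. if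
  \<open>S(c) = c S(1)\<close> for all \<open>c\<close>. As \<open>deg S < q\<close>, this functional identity is an identity of
  polynomials.
\<close>

section \<open>Matrices \<open>E\<close> and their commutators\<close>

lemma E_inject [simp]:
  "E a b c t = E a' b' c' t' \<longleftrightarrow> a = a' \<and> b = b' \<and> c = c' \<and> t = t'"
  by (auto simp: E_def vec_eq_iff forall_4)

lemma E_eq_one_iff: "E a b c t = mat 1 \<longleftrightarrow> a = 0 \<and> b = 0 \<and> c = 0 \<and> t = 0"
  by (simp flip: E_one)

text \<open>Trades the inverses in a commutator for an equation between products, which
  \<open>E_mult\<close> can check directly.\<close>

lemma (in group) commutator_eqI:
  assumes "x \<in> carrier G" "y \<in> carrier G" "z \<in> carrier G"
    and "x \<otimes> y = z \<otimes> (y \<otimes> x)"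
  shows "x \<otimes> y \<otimes> inv x \<otimes> inv y = z"
proof -
  have "x \<otimes> y \<otimes> inv x \<otimes> inv y = x \<otimes> y \<otimes> inv (y \<otimes> x)"
    using assms(1-3) by (simp add: inv_mult_group m_assoc)
  also have "\<dots> = z"
    using assms(1-3) unfolding assms(4) by (simp only: inv_solve_right' m_closed)
  finally show ?thesis .
qed

text \<open>Isolates the group theory, which sees \<open>S\<close> only as an additive map; the
  degree of \<open>S\<close> enters when the functional identity is translated.\<close>

locale additive_poly =
  fixes S :: "'a::field poly"
  assumes add: "poly S (x + y) = poly S x + poly S y"
begin

abbreviation G where "G \<equiv> construction_A S"

sublocale group G
  by (rule group_construction_A) (rule add)

lemma poly_0 [simp]: "poly S 0 = 0"
  using add[of 0 0] by (metis add_cancel_right_left)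

lemma carrier_G: "carrier G = {E a b c (poly S c) | a b c. True}"
  by (simp add: construction_A_def)

lemma mult_G [simp]: "x \<otimes>\<^bsub>G\<^esub> y = x ** y"
  by (simp add: construction_A_def)

lemma one_G [simp]: "\<one>\<^bsub>G\<^esub> = mat 1"
  by (simp add: construction_A_def)

lemma E_in_carrier [simp]: "E a b c (poly S c) \<in> carrier G" "E a b 0 0 \<in> carrier G"
  by (auto simp: carrier_G intro: exI[of _ 0])

text \<open>The last two parameters vanish because they simply add in \<open>E_mult\<close>; the
  first two come from solving \<open>x ** y = ?z ** (y ** x)\<close>.\<close>

lemma commutator_E:
  "E a b c (poly S c) ** E a' b' c' (poly S c')
     ** inv\<^bsub>G\<^esub> E a b c (poly S c) ** inv\<^bsub>G\<^esub> E a' b' c' (poly S c') =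
   E (2 * (c * b' - c' * b) + c\<^sup>2 * poly S c' - c'\<^sup>2 * poly S c)
     (c * poly S c' - c' * poly S c) 0 0" (is "_ = ?z")
  using commutator_eqI[of "E a b c (poly S c)" "E a' b' c' (poly S c')" ?z]
  by (simp add: E_mult algebra_simps power2_eq_square)

lemma commutator_E_derived:
  "E a b 0 0 ** E a' b' c' (poly S c') ** inv\<^bsub>G\<^esub> E a b 0 0 ** inv\<^bsub>G\<^esub> E a' b' c' (poly S c') =
   E (- 2 * b * c') 0 0 0"
  using commutator_E[of a b 0 a' b' c'] by simp

text \<open>On matrices with \<open>c = t = 0\<close>, multiplication adds the \<open>a\<close> and
  the \<open>b\<close> entries. The set \<open>B\<close> is kept general to serve both
  \<open>UNIV\<close> and \<open>{0}\<close> as bounds for terms of the series.\<close>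

lemma subgroup_E:
  assumes "0 \<in> B" "\<And>b b'. b \<in> B \<Longrightarrow> b' \<in> B \<Longrightarrow> b - b' \<in> B"
  shows "subgroup {E a b 0 0 | a b. b \<in> B} G"
proof -
  have minus: "- b \<in> B" if "b \<in> B" for b
    using assms(2)[OF assms(1) that] by simp
  have plus: "b + b' \<in> B" if "b \<in> B" "b' \<in> B" for b b'
    using assms(2)[OF that(1) minus[OF that(2)]] by simp
  have inv_E: "inv\<^bsub>G\<^esub> E a b 0 0 = E (- a) (- b) 0 0" for a b
    by (rule inv_equality) (simp_all add: E_mult E_eq_one_iff)
  show ?thesis
  proof (rule subgroupI)
    show "{E a b 0 0 | a b. b \<in> B} \<noteq> {}"
      using assms(1) by blast
  qed (auto simp: inv_E E_mult minus plus)
qed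

section \<open>Terms of the lower central series\<close>

lemma lower_central_series_Suc_subset:
  assumes "subgroup H G"
    and "\<And>x y. x \<in> lower_central_series G n \<Longrightarrow> y \<in> carrier G \<Longrightarrow>
           x ** y ** inv\<^bsub>G\<^esub> x ** inv\<^bsub>G\<^esub> y \<in> H"
  shows "lower_central_series G (Suc n) \<subseteq> H"
  unfolding lower_central_series.simps using assms by (intro generate_subgroup_incl) auto

lemma commutator_in_lower_central_series:
  assumes "x \<in> lower_central_series G n" "y \<in> carrier G"
  shows "x ** y ** inv\<^bsub>G\<^esub> x ** inv\<^bsub>G\<^esub> y \<in> lower_central_series G (Suc n)"
  using assms by (auto intro!: generate.incl)

lemma one_in_lower_central_series: "mat 1 \<in> lower_central_series G n"
  using generate.one[of G] one_closed by (cases n) auto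

lemma lower_central_series_1_subset:
  assumes "0 \<in> B" "\<And>b b'. b \<in> B \<Longrightarrow> b' \<in> B \<Longrightarrow> b - b' \<in> B"
    and "\<And>c c'. c * poly S c' - c' * poly S c \<in> B"
  shows "lower_central_series G 1 \<subseteq> {E a b 0 0 | a b. b \<in> B}"
  unfolding One_nat_def using assms
  by (intro lower_central_series_Suc_subset subgroup_E) (auto simp: carrier_G commutator_E)

text \<open>The matrices \<open>E a 0 0 0\<close> are central in \<open>G\<close>, so a term made of
  them is followed by the trivial group.\<close>

lemma lower_central_series_Suc_trivial:
  assumes "lower_central_series G n \<subseteq> {E a b 0 0 | a b. b \<in> {0}}"
  shows "lower_central_series G (Suc n) = {mat 1}"
proof -
  have "lower_central_series G (Suc n) \<subseteq> {\<one>\<^bsub>G\<^esub>}"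
  proof (rule lower_central_series_Suc_subset)
    fix x y
    assume "x \<in> lower_central_series G n" "y \<in> carrier G"
    then obtain a a' b' c' where "x = E a 0 0 0" "y = E a' b' c' (poly S c')"
      using assms unfolding carrier_G by blast
    then show "x ** y ** inv\<^bsub>G\<^esub> x ** inv\<^bsub>G\<^esub> y \<in> {\<one>\<^bsub>G\<^esub>}"
      by (simp add: commutator_E_derived E_one)
  qed (rule triv_subgroup)
  then show ?thesis
    using one_in_lower_central_series[of "Suc n"] by auto
qed

lemma lower_central_series_3: "lower_central_series G 3 = {mat 1}"
proof -
  have one: "lower_central_series G 1 \<subseteq> {E a b 0 0 | a b. b \<in> UNIV}"
    by (rule lower_central_series_1_subset) auto
  \<comment> \<open>A commutator whose left factor has \<open>c = 0\<close> keeps only its corner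
    entry, so term 2 is central.\<close>
  have "lower_central_series G (Suc 1) \<subseteq> {E a b 0 0 | a b. b \<in> {0}}"
  proof (rule lower_central_series_Suc_subset)
    fix x y
    assume "x \<in> lower_central_series G 1" "y \<in> carrier G"
    then obtain a b a' b' c' where "x = E a b 0 0" "y = E a' b' c' (poly S c')"
      using one unfolding carrier_G by blast
    then show "x ** y ** inv\<^bsub>G\<^esub> x ** inv\<^bsub>G\<^esub> y \<in> {E a b 0 0 | a b. b \<in> {0}}"
      by (simp add: commutator_E_derived)
  qed (rule subgroup_E, auto)
  from lower_central_series_Suc_trivial[OF this] show ?thesis
    by (simp add: eval_nat_numeral)
qed

lemma lower_central_series_less_2_nontrivial:
  assumes "(2::'a) \<noteq> 0" "n < 2"
  shows "lower_central_series G n \<noteq> {mat 1}"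
proof -
  \<comment> \<open>With \<open>c = b' = 1\<close> and all other parameters zero, the terms
    involving \<open>S\<close> cancel and \<open>2 * c * b'\<close> remains.\<close>
  have "E 2 0 0 0 \<in> lower_central_series G (Suc 0)"
    using commutator_in_lower_central_series[of "E 0 0 1 (poly S 1)" 0 "E 0 1 0 (poly S 0)"]
    by (simp only: commutator_E) simp
  moreover have "E 2 0 0 0 \<in> lower_central_series G 0"
    by simp
  ultimately have "E 2 0 0 0 \<in> lower_central_series G n"
    using assms(2) by (auto simp only: less_2_cases_iff)
  then show ?thesis
    using assms(1) by (auto simp: E_eq_one_iff)
qed

lemma lower_central_series_2_trivial_iff:
  assumes "(2::'a) \<noteq> 0"
  shows "lower_central_series G 2 = {mat 1} \<longleftrightarrow> (\<forall>c. poly S c = c * poly S 1)"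
proof
  assume trivial: "lower_central_series G 2 = {mat 1}"
  show "\<forall>c. poly S c = c * poly S 1"
  proof
    fix c
    let ?\<alpha> = "c\<^sup>2 * poly S 1 - poly S c" and ?\<beta> = "c * poly S 1 - poly S c"
    have "E ?\<alpha> ?\<beta> 0 0 \<in> lower_central_series G (Suc 0)"
      using commutator_in_lower_central_series[of "E 0 0 c (poly S c)" 0 "E 0 0 1 (poly S 1)"]
      by (simp only: commutator_E) simp
    \<comment> \<open>A further commutator with a matrix having \<open>c' = 1\<close> moves
      \<open>?\<beta>\<close> into the corner, up to the invertible factor -2.\<close>
    from commutator_in_lower_central_series[OF this E_in_carrier(1)[of 0 0 1]]
    have "E (- 2 * ?\<beta>) 0 0 0 \<in> lower_central_series G (Suc (Suc 0))"
      by (simp only: commutator_E_derived mult_1_right)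
    then have "E (- 2 * ?\<beta>) 0 0 0 = mat 1"
      using trivial unfolding numeral_2_eq_2 by blast
    then show "poly S c = c * poly S 1"
      using assms by (simp add: E_eq_one_iff)
  qed
next
  assume *: "\<forall>c. poly S c = c * poly S 1"
  have "c * poly S c' - c' * poly S c = 0" for c c'
    \<comment> \<open>Both products equal \<open>c * c' * poly S 1\<close>.\<close>
    using *[rule_format, of c] *[rule_format, of c'] by (metis diff_self mult.left_commute)
  then have "lower_central_series G 1 \<subseteq> {E a b 0 0 | a b. b \<in> {0}}"
    by (intro lower_central_series_1_subset) auto
  from lower_central_series_Suc_trivial[OF this] show "lower_central_series G 2 = {mat 1}"
    by (simp add: numeral_2_eq_2)
qed

lemma nilpotent_G: "nilpotent G"
  unfolding nilpotent_def using is_group lower_central_series_3 by auto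

lemma nilpotency_class_G:
  assumes "(2::'a) \<noteq> 0"
  shows "nilpotency_class G = (if \<forall>c. poly S c = c * poly S 1 then 2 else 3)"
proof -
  have "n \<ge> 2" if "lower_central_series G n = {mat 1}" for n
    using lower_central_series_less_2_nontrivial[OF assms, of n] that by linarith
  moreover have "n \<noteq> 2"
    if "lower_central_series G n = {mat 1}" "\<not> (\<forall>c. poly S c = c * poly S 1)" for n
    using lower_central_series_2_trivial_iff[OF assms] that by blast
  ultimately have "n \<ge> 3"
    if "lower_central_series G n = {mat 1}" "\<not> (\<forall>c. poly S c = c * poly S 1)" for n
    using that by (metis Suc_leI le_neq_implies_less numeral_2_eq_2 numeral_3_eq_3)
  with \<open>\<And>n. lower_central_series G n = {mat 1} \<Longrightarrow> n \<ge> 2\<close> show ?thesis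
    unfolding nilpotency_class_def
    using lower_central_series_2_trivial_iff[OF assms] lower_central_series_3
    by (auto intro!: Least_equality)
qed

end

section \<open>From the functional identity to the degree of \<open>S\<close>\<close>

lemma poly_eq_mult_iff_degree_le_1:
  fixes S :: "'a::{field,finite} poly"
  assumes "poly S 0 = 0" "degree S < CARD('a)"
  shows "(\<forall>c. poly S c = c * poly S 1) \<longleftrightarrow> degree S \<le> 1"
proof
  assume *: "\<forall>c. poly S c = c * poly S 1"
  \<comment> \<open>A field has at least two elements, so a polynomial of degree at most 1 has
    degree below \<open>CARD('a)\<close>.\<close>
  have "card {0, 1 :: 'a} \<le> CARD('a)"
    by (rule card_mono) auto
  then have "degree [:0, poly S 1:] < CARD('a)"
    by (simp add: degree_pCons_eq_if)
  moreover have "poly S x = poly [:0, poly S 1:] x" for x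
    using *[rule_format, of x] by simp
  \<comment> \<open>Two polynomials of degree below \<open>CARD('a)\<close> that agree on the whole
    field are equal.\<close>
  ultimately have S: "S = [:0, poly S 1:]"
    using assms(2) by (intro poly_eqI_degree[where A = UNIV])
  show "degree S \<le> 1"
    by (subst S) (simp add: degree_pCons_eq_if)
next
  assume "degree S \<le> 1"
  then obtain a b where "S = [:a, b:]"
    by (metis degree1_coeffs degree_eq_zeroE le_neq_implies_less less_one pCons_0_0)
  with assms(1) show "\<forall>c. poly S c = c * poly S 1"
    by simp
qed

text \<open>Every exponent is some \<open>p ^ i\<close> with \<open>i < m\<close>; for
  \<open>m = 0\<close> the sum is empty and the bound reads \<open>0 < 1\<close>.\<close>

lemma degree_linearized_poly_less:
  assumes "p > 1"
  shows "degree (linearized_poly p m s) < p ^ m"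
  using assms unfolding linearized_poly_def
  by (intro degree_sum_less) (auto intro: le_less_trans[OF degree_monom_le])

theorem theorem8p7:
  fixes p m :: nat and s :: "nat \<Rightarrow> 'a::{field,finite}"
  assumes "prime p" and "CARD('a) = p ^ m" and "odd (p ^ m)"
  shows "let S\<^sub>1 = linearized_poly p m s; G = construction_A S\<^sub>1 in
           nilpotent G \<and>
           (nilpotency_class G = 2 \<or> nilpotency_class G = 3) \<and>
           (nilpotency_class G = 3 \<longleftrightarrow> degree S\<^sub>1 > 1)"
proof -
  define S where "S = linearized_poly p m s"
  interpret additive_poly S
    by unfold_locales (simp add: S_def poly_linearized_poly_add[OF assms(1,2)])
  \<comment> \<open>Oddness of \<open>p ^ m\<close> passes to \<open>p\<close> only for a positive
    exponent; \<open>m = 0\<close> would give a field with one element.\<close>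
  have "m \<noteq> 0"
  proof
    assume "m = 0"
    then have "CARD('a) = 1"
      using assms(2) by simp
    then show False
      by (metis card_1_singletonE UNIV_I singletonD zero_neq_one)
  qed
  then have "odd p"
    using assms(3) by simp
  then have "\<not> CHAR('a) dvd 2"
    using CHAR_of_card[OF assms(1,2)] primes_dvd_imp_eq[OF assms(1) two_is_prime_nat] by auto
  then have "(2::'a) \<noteq> 0"
    by (metis of_nat_eq_0_iff_char_dvd of_nat_numeral)
  moreover have "degree S < CARD('a)"
    unfolding S_def assms(2) using assms(1) by (intro degree_linearized_poly_less prime_gt_1_nat)
  ultimately have "nilpotency_class G = (if degree S \<le> 1 then 2 else 3)"
    using nilpotency_class_G poly_eq_mult_iff_degree_le_1[OF poly_0] by simp
  with nilpotent_G show ?thesis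
    by (simp add: Let_def flip: S_def)
qed

end
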